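(* Let $n$ be a positive integer. There exists a separable convex function $f:\mathbb{R}^n\to\mathbb{R}$ which is not $(c^{nN})$-reducible for any $c<\phi$, where $\phi=\frac{1+\sqrt5}{2}$ is the golden ratio; that is, for every real $0<c<\phi$ there is $N\in\mathbb{N}$ such that no separable convex function $g:[-N,N]^n\to\mathbb{Z}$ that is equivalent to $f$ on $[-N,N]^n$ satisfies $g_{\max}^{[-N,N]^n}\le c^{nN}$.
   Context: A function is separable convex if it has the form $f(x)=\sum_{i=1}^n f_i(x_i)$ with each $f_i$ convex in one variable (on integer points of an interval, convexity means $h(x)+h(x+2)\ge 2h(x+1)$). $[-N,N]^n$ denotes the set of integer points $x\in\mathbb{Z}^n$ with $-N\le x_i\le N$. Functions $f,g$ are equivalent on $D\subseteq\mathbb{Z}^n$ if for all $x,y\in D$: $f(x)\ge f(y)\Leftrightarrow g(x)\ge g(y)$. For a box $D$, $g_{\max}^D:=\max_{x,x'\in D}|g(x)-g(x')|$. A separable convex $f:\mathbb{R}^n\to\mathbb{R}$ is $\rho$-reducible if for every $N\in\mathbb{N}$ there is a separable convex $g:[-N,N]^n\to\mathbb{Z}$ equivalent to $f$ on $[-N,N]^n$ with $g_{\max}^{[-N,N]^n}\le\rho(N)$. *)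

theory Defs
  imports "HOL-Analysis.Analysis"
begin

definition separable_convex :: "(real ^ 'n \<Rightarrow> real) \<Rightarrow> bool" where
  "separable_convex f \<longleftrightarrow>
     (\<exists>h :: 'n \<Rightarrow> real \<Rightarrow> real. (\<forall>i. convex_on UNIV (h i)) \<and> (\<forall>x. f x = (\<Sum>i\<in>UNIV. h i (x $ i))))"

definition int_box :: "nat \<Rightarrow> (int ^ 'n) set" where
  "int_box N = {x. \<forall>i. - int N \<le> x $ i \<and> x $ i \<le> int N}"

definition int_convex_on_interval :: "int \<Rightarrow> int \<Rightarrow> (int \<Rightarrow> real) \<Rightarrow> bool" where
  "int_convex_on_interval a b h \<longleftrightarrow> (\<forall>x. a \<le> x \<and> x + 2 \<le> b \<longrightarrow> h x + h (x + 2) \<ge> 2 * h (x + 1))"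

text \<open>
  Separable convexity of a function on the box \<open>[-N,N]\<^sup>n\<close>; its values outside the box are
  irrelevant.  The summands may be real-valued even if the function itself is integer-valued.
\<close>

definition separable_convex_on_box :: "nat \<Rightarrow> (int ^ 'n \<Rightarrow> real) \<Rightarrow> bool" where
  "separable_convex_on_box N g \<longleftrightarrow>
     (\<exists>h :: 'n \<Rightarrow> int \<Rightarrow> real. (\<forall>i. int_convex_on_interval (- int N) (int N) (h i)) \<and>
        (\<forall>x \<in> int_box N. g x = (\<Sum>i\<in>UNIV. h i (x $ i))))"

definition equivalent_on :: "'a set \<Rightarrow> ('a \<Rightarrow> 'b::linorder) \<Rightarrow> ('a \<Rightarrow> 'c::linorder) \<Rightarrow> bool" where
  "equivalent_on D f g \<longleftrightarrow> (\<forall>x\<in>D. \<forall>y\<in>D. f x \<ge> f y \<longleftrightarrow> g x \<ge> g y)"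

definition max_variation :: "'a set \<Rightarrow> ('a \<Rightarrow> int) \<Rightarrow> int" where
  "max_variation D g = Max {\<bar>g x - g x'\<bar> | x x'. x \<in> D \<and> x' \<in> D}"

definition real_vec :: "int ^ 'n \<Rightarrow> real ^ 'n" where
  "real_vec x = (\<chi> i. real_of_int (x $ i))"

definition reducible :: "(nat \<Rightarrow> real) \<Rightarrow> (real ^ 'n \<Rightarrow> real) \<Rightarrow> bool" where
  "reducible \<rho> f \<longleftrightarrow>
     (\<forall>N. \<exists>g :: int ^ 'n \<Rightarrow> int.
        separable_convex_on_box N (\<lambda>x. real_of_int (g x)) \<and>
        equivalent_on (int_box N) (\<lambda>x. f (real_vec x)) g \<and>
        real_of_int (max_variation (int_box N) g) \<le> \<rho> N)"

text \<open>The maximum defining \<open>max_variation\<close> is over a finite nonempty set when the domain is a box.\<close>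

lemma finite_int_box: "finite (int_box N :: (int ^ 'n) set)"
proof -
  have "int_box N \<subseteq> vec_lambda ` (PiE (UNIV :: 'n set) (\<lambda>_. {- int N..int N}))"
  proof
    fix x :: "int ^ 'n" assume "x \<in> int_box N"
    then have "vec_nth x \<in> PiE UNIV (\<lambda>_. {- int N..int N})"
      by (auto simp: int_box_def)
    then show "x \<in> vec_lambda ` (PiE (UNIV :: 'n set) (\<lambda>_. {- int N..int N}))"
      by (metis imageI vec_nth_inverse)
  qed
  then show ?thesis
    by (rule finite_subset) (auto intro!: finite_imageI finite_PiE)
qed

lemma int_box_nonempty: "int_box N \<noteq> {}"
proof -
  have "0 \<in> int_box N" by (simp add: int_box_def)
  then show ?thesis by blast
qed

end

theory Submission imports Defs begin

text \<open>
  The \<open>2n\<close> coordinate rays carry convex functions that are interleaved in blocks of four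
  consecutive integer points: the blocks are numbered cyclically through the rays, and \<open>f\<close> is larger on
  block \<open>t + 1\<close> than on block \<open>t\<close>. Let \<open>D t\<close> be the increment of an equivalent \<open>g\<close> along the edge
  entering block \<open>t\<close>. This edge jumps over the whole of block \<open>t - 1\<close>, which consists of three edges
  whose increments are at least \<open>D (t - 1)\<close> by convexity. Hence \<open>D t \<ge> 3 * D (t - 1)\<close>, and
  for \<open>N = 4 * M\<close> there are \<open>2 * n * M\<close> blocks, so the variation of \<open>g\<close> is of order at least
  \<open>9 ^ (n * M) = sqrt 3 ^ (n * N)\<close>, and \<open>sqrt 3\<close> exceeds the golden ratio.
\<close>

section \<open>Convex piecewise linear functions on a ray\<close>

text \<open>Stands for the infinite series over all \<open>m\<close>: beyond the cutoff the terms
  vanish, so no convergence question arises. Slopes change only at multiples of 4.\<close>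

definition hinge_sum :: "(nat \<Rightarrow> real) \<Rightarrow> real \<Rightarrow> real" where
  "hinge_sum w x = (\<Sum>m\<le>nat \<lceil>x\<rceil>. w m * max 0 (x - 4 * real m))"

lemma hinge_sum_eq:
  assumes "x \<le> 4 * real M + 4"
  shows "hinge_sum w x = (\<Sum>m\<le>M. w m * max 0 (x - 4 * real m))"
proof -
  have "(\<Sum>m\<le>M. w m * max 0 (x - 4 * real m))
      = (\<Sum>m\<le>max M (nat \<lceil>x\<rceil>). w m * max 0 (x - 4 * real m))"
  proof (rule sum.mono_neutral_left)
    show "\<forall>m\<in>{..max M (nat \<lceil>x\<rceil>)} - {..M}. w m * max 0 (x - 4 * real m) = 0"
    proof
      fix m assume "m \<in> {..max M (nat \<lceil>x\<rceil>)} - {..M}"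
      then have "real M + 1 \<le> real m" by auto
      with assms show "w m * max 0 (x - 4 * real m) = 0" by simp
    qed
  qed auto
  moreover have "hinge_sum w x = (\<Sum>m\<le>max M (nat \<lceil>x\<rceil>). w m * max 0 (x - 4 * real m))"
    unfolding hinge_sum_def
  proof (rule sum.mono_neutral_left)
    show "\<forall>m\<in>{..max M (nat \<lceil>x\<rceil>)} - {..nat \<lceil>x\<rceil>}. w m * max 0 (x - 4 * real m) = 0"
    proof
      fix m assume "m \<in> {..max M (nat \<lceil>x\<rceil>)} - {..nat \<lceil>x\<rceil>}"
      then have "nat \<lceil>x\<rceil> < m" by auto
      then have "x \<le> real m" by linarith
      then have "x - 4 * real m \<le> 0" by simp
      then show "w m * max 0 (x - 4 * real m) = 0" by simp
    qed
  qed auto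
  ultimately show ?thesis by simp
qed

lemma hinge_sum_nonpos: "x \<le> 0 \<Longrightarrow> hinge_sum w x = 0"
  using hinge_sum_eq[of x 0 w] by simp

lemma convex_on_hinge_sum:
  assumes "\<And>m. w m \<ge> 0"
  shows "convex_on UNIV (hinge_sum w)"
proof (rule convex_onI)
  fix u x y :: real
  assume u: "0 < u" "u < 1"
  define z where "z = (1 - u) *\<^sub>R x + u *\<^sub>R y"
  \<comment> \<open>A common cutoff for all three points reduces the claim to single hinges.\<close>
  obtain M :: nat where M: "max x (max y z) \<le> real M" using real_arch_simple by blast
  let ?h = "\<lambda>x. \<Sum>m\<le>M. w m * max 0 (x - 4 * real m)"
  have eq: "hinge_sum w v = ?h v" if "v \<le> real M" for v
    using that by (intro hinge_sum_eq) simp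
  have hinge: "max 0 (z - 4 * real m) \<le> (1 - u) * max 0 (x - 4 * real m) + u * max 0 (y - 4 * real m)"
    for m
  proof -
    have "(1 - u) * (x - 4 * real m) \<le> (1 - u) * max 0 (x - 4 * real m)"
      "u * (y - 4 * real m) \<le> u * max 0 (y - 4 * real m)"
      using u by (auto intro!: mult_left_mono)
    moreover have "0 \<le> (1 - u) * max 0 (x - 4 * real m)" "0 \<le> u * max 0 (y - 4 * real m)"
      using u by auto
    moreover have "z - 4 * real m = (1 - u) * (x - 4 * real m) + u * (y - 4 * real m)"
      by (simp add: z_def algebra_simps)
    ultimately show ?thesis by linarith
  qed
  have "?h z \<le> (\<Sum>m\<le>M. w m * ((1 - u) * max 0 (x - 4 * real m) + u * max 0 (y - 4 * real m)))"
    by (intro sum_mono mult_left_mono hinge assms)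
  also have "\<dots> = (1 - u) * ?h x + u * ?h y"
    by (simp only: distrib_left sum.distrib sum_distrib_left mult.left_commute)
  finally have "?h z \<le> (1 - u) * ?h x + u * ?h y" .
  then show "hinge_sum w ((1 - u) *\<^sub>R x + u *\<^sub>R y) \<le> (1 - u) * hinge_sum w x + u * hinge_sum w y"
    using M eq[of x] eq[of y] eq[of z] by (simp add: z_def)
qed simp

section \<open>Growth along the blocks of a ray\<close>

text \<open>\<open>k + p * m\<close> is the global number of block \<open>m\<close> of ray
  \<open>k\<close> when \<open>p\<close> rays take turns; this block has the distances
  \<open>4 * m + 1\<close> to \<open>4 * m + 4\<close>.\<close>

definition ray_weight :: "nat \<Rightarrow> nat \<Rightarrow> nat \<Rightarrow> real" where
  "ray_weight p k m = 17 ^ (k + p * m)"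

text \<open>The newest hinge alone contributes this much.\<close>

lemma hinge_sum_block_start:
  "17 ^ (k + p * m) \<le> hinge_sum (ray_weight p k) (4 * real m + 1)"
proof -
  let ?t = "\<lambda>j. ray_weight p k j * max 0 (4 * real m + 1 - 4 * real j)"
  have "?t m \<le> sum ?t {..m}"
    by (rule member_le_sum) (auto simp: ray_weight_def)
  also have "\<dots> = hinge_sum (ray_weight p k) (4 * real m + 1)"
    by (rule hinge_sum_eq[symmetric]) simp
  finally show ?thesis by (simp add: ray_weight_def)
qed

lemma hinge_sum_block_end:
  assumes "p > 0"
  shows "hinge_sum (ray_weight p k) (4 * real m + 4) \<le> 16 * 17 ^ (k + p * m)"
proof -
  let ?w = "ray_weight p k"
  have step: "17 * ?w j \<le> ?w (Suc j)" for j
  proof -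
    have "(17::real) ^ Suc (k + p * j) \<le> 17 ^ (k + p * Suc j)"
      by (rule power_increasing) (use assms in auto)
    then show ?thesis by (simp add: ray_weight_def)
  qed
  have pos: "0 < ?w j" for j by (simp add: ray_weight_def)
  have S: "sum ?w {..j} \<le> 2 * ?w j" for j
  proof (induction j)
    case (Suc j)
    then show ?case using step[of j] pos[of j] by simp
  qed (simp add: ray_weight_def)
  \<comment> \<open>One more block extends every hinge by 4, adding at most 8 times the newest
    weight by \<open>S\<close>; the older value is below one newest weight by
    \<open>step\<close>.\<close>
  have A: "(\<Sum>j\<le>m. ?w j * (4 * real m + 4 - 4 * real j)) \<le> 16 * ?w m" for m
  proof (induction m)
    case 0
    then show ?case using pos[of 0] by simp
  next
    case (Suc m)
    have "(\<Sum>j\<le>Suc m. ?w j * (4 * real (Suc m) + 4 - 4 * real j))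
        = (\<Sum>j\<le>m. ?w j * (4 * real m + 4 - 4 * real j)) + 4 * sum ?w {..Suc m}"
      by (simp add: sum_distrib_left sum.distrib[symmetric] algebra_simps)
    also have "\<dots> \<le> 16 * ?w m + 8 * ?w (Suc m)"
      using Suc S[of "Suc m"] by linarith
    also have "\<dots> \<le> 16 * ?w (Suc m)"
      using step[of m] pos[of m] by linarith
    finally show ?case .
  qed
  have "hinge_sum ?w (4 * real m + 4) = (\<Sum>j\<le>m. ?w j * max 0 (4 * real m + 4 - 4 * real j))"
    by (rule hinge_sum_eq) simp
  also have "\<dots> = (\<Sum>j\<le>m. ?w j * (4 * real m + 4 - 4 * real j))"
    by (rule sum.cong) auto
  also have "\<dots> \<le> 16 * ?w m" by (rule A)
  finally show ?thesis by (simp add: ray_weight_def)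
qed

text \<open>Base 17 exceeds the factor 16 by which values can grow within a block.\<close>

lemma hinge_sum_blocks_ordered:
  assumes "p > 0" "k + p * m < k' + p * m'"
  shows "hinge_sum (ray_weight p k) (4 * real m + 4) < hinge_sum (ray_weight p k') (4 * real m' + 1)"
proof -
  have "hinge_sum (ray_weight p k) (4 * real m + 4) \<le> 16 * 17 ^ (k + p * m)"
    by (rule hinge_sum_block_end[OF assms(1)])
  also have "\<dots> < 17 ^ Suc (k + p * m)" by simp
  also have "\<dots> \<le> 17 ^ (k' + p * m')"
    by (rule power_increasing) (use assms in auto)
  also have "\<dots> \<le> hinge_sum (ray_weight p k') (4 * real m' + 1)"
    by (rule hinge_sum_block_start)
  finally show ?thesis .
qed

section \<open>Consequences of equivalence, variation and separable convexity\<close>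

lemma equivalent_on_less_iff:
  assumes "equivalent_on D f g" "x \<in> D" "y \<in> D"
  shows "f x < f y \<longleftrightarrow> g x < g y"
  using assms unfolding equivalent_on_def by (meson not_le)

lemma le_max_variation:
  assumes "finite D" "x \<in> D" "y \<in> D"
  shows "g x - g y \<le> max_variation D g"
proof -
  have "{\<bar>g x - g x'\<bar> | x x'. x \<in> D \<and> x' \<in> D} = (\<lambda>(x, x'). \<bar>g x - g x'\<bar>) ` (D \<times> D)"
    by auto
  then have "finite {\<bar>g x - g x'\<bar> | x x'. x \<in> D \<and> x' \<in> D}"
    using assms(1) by simp
  then have "\<bar>g x - g y\<bar> \<le> max_variation D g"
    unfolding max_variation_def using assms by (intro Max_ge) auto
  then show ?thesis by linarith
qed

text \<open>Along an axis the other summands add up to a constant \<open>C\<close>; the sign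
  \<open>s\<close> treats both half-axes as rays leaving the origin.\<close>

lemma separable_convex_on_box_axis:
  fixes g :: "int ^ 'n \<Rightarrow> real"
  assumes "separable_convex_on_box N g" "d + 2 \<le> N" "s = 1 \<or> s = (-1::int)"
  shows "2 * g (axis i (s * int (d + 1))) \<le> g (axis i (s * int d)) + g (axis i (s * int (d + 2)))"
proof -
  obtain h :: "'n \<Rightarrow> int \<Rightarrow> real"
    where h: "\<And>i. int_convex_on_interval (- int N) (int N) (h i)"
      and g: "\<And>x. x \<in> int_box N \<Longrightarrow> g x = (\<Sum>i\<in>UNIV. h i (x $ i))"
    using assms(1) unfolding separable_convex_on_box_def by auto
  define C where "C = (\<Sum>j\<in>UNIV - {i}. h j 0)"
  have ax: "g (axis i (s * int e)) = h i (s * int e) + C" if "e \<le> N" for e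
  proof -
    have "axis i (s * int e) \<in> int_box N"
      using that assms(3) by (auto simp: int_box_def axis_def)
    then have "g (axis i (s * int e)) = (\<Sum>j\<in>UNIV. h j (axis i (s * int e) $ j))"
      by (rule g)
    also have "\<dots> = h i (s * int e) + (\<Sum>j\<in>UNIV - {i}. h j (axis i (s * int e) $ j))"
      by (subst sum.remove[of _ i]) (auto simp: axis_def)
    also have "(\<Sum>j\<in>UNIV - {i}. h j (axis i (s * int e) $ j)) = C"
      unfolding C_def by (rule sum.cong) (auto simp: axis_def)
    finally show ?thesis .
  qed
  have "2 * h i (s * int (d + 1)) \<le> h i (s * int d) + h i (s * int (d + 2))"
    using assms(3)
  proof
    assume "s = 1"
    then show ?thesis
      using h[of i, unfolded int_convex_on_interval_def, rule_format, of "int d"] assms(2)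
      by (simp add: add.commute)
  next
    assume s: "s = -1"
    have "2 * h i (- int (d + 2) + 1) \<le> h i (- int (d + 2)) + h i (- int (d + 2) + 2)"
      using h[of i, unfolded int_convex_on_interval_def, rule_format, of "- int (d + 2)"] assms(2)
      by simp
    moreover have "- int (d + 2) + 1 = s * int (d + 1)" "- int (d + 2) + 2 = s * int d"
      "- int (d + 2) = s * int (d + 2)" using s by auto
    ultimately show ?thesis by (metis add.commute)
  qed
  then show ?thesis
    using assms(2) ax[of d] ax[of "d + 1"] ax[of "d + 2"] by linarith
qed

section \<open>The interleaved function on the rays\<close>

text \<open>Ray \<open>k\<close> is the positive (\<open>k\<close> even) or negative (\<open>k\<close> odd) half of the axis with number \<open>k div 2\<close>.\<close>

definition ray_point :: "('n \<Rightarrow> nat) \<Rightarrow> nat \<Rightarrow> nat \<Rightarrow> int ^ 'n" where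
  "ray_point e k d = axis (inv_into UNIV e (k div 2)) ((if even k then 1 else -1) * int d)"

definition interleaved :: "('n \<Rightarrow> nat) \<Rightarrow> real ^ 'n \<Rightarrow> real" where
  "interleaved e x = (\<Sum>i\<in>UNIV. hinge_sum (ray_weight (2 * CARD('n)) (2 * e i)) (x $ i)
     + hinge_sum (ray_weight (2 * CARD('n)) (2 * e i + 1)) (- (x $ i)))"

lemma separable_convex_interleaved: "separable_convex (interleaved e)"
proof -
  have conv: "convex_on UNIV (hinge_sum (ray_weight p k))" for p k
    by (rule convex_on_hinge_sum) (simp add: ray_weight_def)
  have "convex_on UNIV (\<lambda>x. hinge_sum (ray_weight p k) (- x))" for p k
    using conv[of p k] unfolding convex_on_def
    by (auto simp del: minus_add_distrib) (metis (no_types) minus_add_distrib mult_minus_right)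
  then have "convex_on UNIV (\<lambda>x. hinge_sum (ray_weight p k) x + hinge_sum (ray_weight p k') (- x))"
    for p k k' using conv[of p k] by (intro convex_on_add)
  then show ?thesis
    unfolding separable_convex_def
    by (intro exI[of _ "\<lambda>i x. hinge_sum (ray_weight (2 * CARD('a)) (2 * e i)) x
      + hinge_sum (ray_weight (2 * CARD('a)) (2 * e i + 1)) (- x)"])
       (auto simp: interleaved_def)
qed

text \<open>\<open>hinge_sum\<close> vanishes at nonpositive arguments, so only the summand of ray
  \<open>k\<close> survives.\<close>

lemma interleaved_ray_point:
  fixes e :: "'n::finite \<Rightarrow> nat"
  assumes e: "bij_betw e UNIV {..<CARD('n)}" and k: "k < 2 * CARD('n)"
  shows "interleaved e (real_vec (ray_point e k d)) = hinge_sum (ray_weight (2 * CARD('n)) k) (real d)"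
proof -
  define j where "j = inv_into UNIV e (k div 2)"
  have ej: "e j = k div 2"
    unfolding j_def using e k by (intro f_inv_into_f) (auto simp: bij_betw_def)
  let ?W = "ray_weight (2 * CARD('n))"
  have "interleaved e (real_vec (ray_point e k d))
     = (\<Sum>i\<in>UNIV. if i = j then hinge_sum (?W k) (real d) else 0)"
    unfolding interleaved_def
  proof (rule sum.cong)
    fix i
    show "hinge_sum (?W (2 * e i)) (real_vec (ray_point e k d) $ i)
        + hinge_sum (?W (2 * e i + 1)) (- (real_vec (ray_point e k d) $ i))
      = (if i = j then hinge_sum (?W k) (real d) else 0)"
    proof (cases "i = j")
      case True
      show ?thesis
      proof (cases "even k")
        case ev: True
        then have "2 * e j = k" using ej by simp
        then show ?thesis using True ev
          by (simp add: ray_point_def real_vec_def j_def[symmetric] hinge_sum_nonpos)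
      next
        case odd: False
        then have "2 * e j + 1 = k" using ej by simp
        then show ?thesis using True odd
          by (simp add: ray_point_def real_vec_def j_def[symmetric] hinge_sum_nonpos)
      qed
    next
      case False
      then show ?thesis
        by (simp add: ray_point_def real_vec_def j_def[symmetric] axis_def hinge_sum_nonpos)
    qed
  qed simp
  then show ?thesis by simp
qed

section \<open>Exponential growth of the increments\<close>

text \<open>The count starts at block \<open>2 * CARD('n)\<close>, the first one entered from
  another block instead of the origin; the box holds \<open>2 * CARD('n) * M\<close> blocks.\<close>

lemma max_variation_lower_bound:
  fixes e :: "'n::finite \<Rightarrow> nat" and g :: "int ^ 'n \<Rightarrow> int"
  assumes e: "bij_betw e UNIV {..<CARD('n)}"
    and conv: "separable_convex_on_box (4 * M) (\<lambda>x. real_of_int (g x))"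
    and equiv: "equivalent_on (int_box (4 * M)) (\<lambda>x. interleaved e (real_vec x)) g"
    and r: "2 * CARD('n) + r < 2 * CARD('n) * M"
  shows "3 ^ r \<le> max_variation (int_box (4 * M)) g"
proof -
  define p where "p = 2 * CARD('n)"
  have p: "p > 1" using zero_less_card_finite[where 'a='n] unfolding p_def by linarith
  \<comment> \<open>Indices 1 to 4 run through block \<open>t\<close>; index 0 is the point of its
    ray just before it.\<close>
  define u where "u t j = g (ray_point e (t mod p) (4 * (t div p) + j))" for t j
  have box: "ray_point e k d \<in> int_box (4 * M)" if "d \<le> 4 * M" for k d
    using that by (auto simp: int_box_def ray_point_def axis_def)
  have len: "4 * (t div p) + 4 \<le> 4 * M" if "t < p * M" for t
  proof -
    have "t div p < M" using that p by (simp add: less_mult_imp_div_less mult.commute)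
    then show ?thesis by simp
  qed
  have order: "u t 4 < u t' 1" if "t < t'" "t' < p * M" for t t'
  proof -
    let ?x = "ray_point e (t mod p) (4 * (t div p) + 4)"
    let ?y = "ray_point e (t' mod p) (4 * (t' div p) + 1)"
    have "hinge_sum (ray_weight p (t mod p)) (4 * real (t div p) + 4)
        < hinge_sum (ray_weight p (t' mod p)) (4 * real (t' div p) + 1)"
      by (rule hinge_sum_blocks_ordered) (use p that in auto)
    moreover have "interleaved e (real_vec (ray_point e (a mod p) d))
        = hinge_sum (ray_weight p (a mod p)) (real d)" for a d
      using interleaved_ray_point[OF e, of "a mod p"] p by (simp add: p_def)
    ultimately have "interleaved e (real_vec ?x) < interleaved e (real_vec ?y)"
      by (simp only: of_nat_add of_nat_mult of_nat_numeral of_nat_1)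
    moreover have "?x \<in> int_box (4 * M)" "?y \<in> int_box (4 * M)"
      using len[of t] len[of t'] that by (auto intro!: box)
    ultimately show ?thesis
      using equivalent_on_less_iff[OF equiv, of ?x ?y] by (simp add: u_def)
  qed
  have convex: "2 * u t (Suc j) \<le> u t j + u t (Suc (Suc j))" if "t < p * M" "j \<le> 2" for t j
  proof -
    have "real_of_int (2 * u t (Suc j)) \<le> real_of_int (u t j + u t (Suc (Suc j)))"
      using separable_convex_on_box_axis[OF conv,
          of "4 * (t div p) + j" "if even (t mod p) then 1 else -1"
             "inv_into UNIV e (t mod p div 2)"] len[OF that(1)] that(2)
      by (cases "even (t mod p)") (simp_all add: u_def ray_point_def)
    then show ?thesis by linarith
  qed
  have span: "3 * (u t 1 - u t 0) \<le> u t 4 - u t 1" if "t < p * M" for t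
    using convex[OF that, of 0] convex[OF that, of 1] convex[OF that, of 2]
    by (simp add: numeral_eq_Suc)
  have prev: "u (p + t) 0 = u t 4" for t
    using p by (simp add: u_def add.commute)
  have "3 ^ r \<le> u (p + r) 1 - u (p + r) 0"
    using r unfolding p_def[symmetric]
  proof (induction r)
    case 0
    \<comment> \<open>A strict increase of the integer-valued \<open>g\<close> is at least
      1.\<close>
    then show ?case using order[of 0 p] prev[of 0] p by simp
  next
    case (Suc r)
    have "3 * 3 ^ r \<le> 3 * (u (p + r) 1 - u (p + r) 0)" using Suc by simp
    also have "\<dots> \<le> u (p + r) 4 - u (p + r) 1" using Suc.prems by (intro span) simp
    \<comment> \<open>The edge entering block \<open>p + Suc r\<close> starts at the end of block
      \<open>Suc r\<close>. As \<open>p > 1\<close>, that block precedes \<open>p + r\<close>, so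
      the edge spans all of block \<open>p + r\<close>.\<close>
    also have "\<dots> \<le> u (p + Suc r) 1 - u (Suc r) 4"
      using order[of "p + r" "p + Suc r"] order[of "Suc r" "p + r"] Suc.prems p by simp
    also have "u (Suc r) 4 = u (p + Suc r) 0" by (rule prev[symmetric])
    finally show ?case by simp
  qed
  also have "\<dots> \<le> max_variation (int_box (4 * M)) g"
    unfolding u_def using len[of "p + r"] r
    by (intro le_max_variation finite_int_box box) (auto simp: p_def[symmetric])
  finally show ?thesis .
qed

theorem theorem74:
  "\<exists>f :: real ^ 'n \<Rightarrow> real. separable_convex f \<and>
     (\<forall>c::real. 0 < c \<and> c < (1 + sqrt 5) / 2 \<longrightarrow>
        \<not> reducible (\<lambda>N. c ^ (CARD('n) * N)) f)"
proof -
  obtain e :: "'n \<Rightarrow> nat" where e: "bij_betw e UNIV {..<CARD('n)}"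
    using ex_bij_betw_finite_nat[of "UNIV :: 'n set"] by (auto simp: atLeast0LessThan)
  have "\<not> reducible (\<lambda>N. c ^ (CARD('n) * N)) (interleaved e)"
    if c: "0 < c" "c < (1 + sqrt 5) / 2" for c
  proof
    assume red: "reducible (\<lambda>N. c ^ (CARD('n) * N)) (interleaved e)"
    let ?n = "CARD('n)"
    have n: "?n > 0" by simp
    \<comment> \<open>The rational \<open>17 / 10\<close> separates the golden ratio from
      \<open>sqrt 3\<close>.\<close>
    have "sqrt 5 < 24 / 10" by (rule real_less_lsqrt) (auto simp: power2_eq_square)
    then have "c < 17 / 10" using c by simp
    then have "c ^ 4 \<le> (17 / 10) ^ 4" using c by (intro power_mono) auto
    also have "\<dots> < 9" by (simp add: power_divide)
    finally have "1 < 9 / c ^ 4" using c by simp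
    \<comment> \<open>The gain in base must outweigh the constant factor lost because the recursion
      skips the first blocks.\<close>
    then obtain M0 where M0: "3 ^ (2 * ?n + 1) < (9 / c ^ 4) ^ M0"
      using real_arch_pow by blast
    \<comment> \<open>The extra 2 keeps the natural subtraction defining \<open>r\<close> from
      truncating.\<close>
    define M where "M = M0 + 2"
    have "(9 / c ^ 4) ^ M0 \<le> (9 / c ^ 4) ^ (?n * M)"
    proof (rule power_increasing)
      have "M0 \<le> 1 * M" by (simp add: M_def)
      also have "\<dots> \<le> ?n * M" using n by (intro mult_le_mono) auto
      finally show "M0 \<le> ?n * M" .
    qed (use \<open>1 < 9 / c ^ 4\<close> in simp)
    with M0 have "3 ^ (2 * ?n + 1) < (9 / c ^ 4) ^ (?n * M)" by linarith
    then have "3 ^ (2 * ?n + 1) * (c ^ 4) ^ (?n * M) < 9 ^ (?n * M)"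
      using c by (simp add: power_divide pos_less_divide_eq)
    moreover have "(9::real) ^ (?n * M) = 3 ^ (2 * ?n * M)"
      by (simp add: power_mult mult.assoc)
    moreover have "(c ^ 4) ^ (?n * M) = c ^ (?n * (4 * M))"
      by (simp add: power_mult[symmetric] algebra_simps)
    moreover
    \<comment> \<open>The largest exponent that \<open>max_variation_lower_bound\<close>
      admits.\<close>
    define r where "r = 2 * ?n * M - (2 * ?n + 1)"
    have "2 * ?n * M = 2 * ?n * M0 + 4 * ?n" by (simp add: M_def algebra_simps)
    then have r: "2 * ?n * M = 2 * ?n + 1 + r" using n unfolding r_def by linarith
    ultimately have less: "c ^ (?n * (4 * M)) < 3 ^ r"
      by (simp add: power_add)
    obtain g :: "int ^ 'n \<Rightarrow> int"
      where g: "separable_convex_on_box (4 * M) (\<lambda>x. real_of_int (g x))"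
        "equivalent_on (int_box (4 * M)) (\<lambda>x. interleaved e (real_vec x)) g"
        "real_of_int (max_variation (int_box (4 * M)) g) \<le> c ^ (?n * (4 * M))"
      using red unfolding reducible_def by blast
    have "3 ^ r \<le> max_variation (int_box (4 * M)) g"
      using r by (intro max_variation_lower_bound[OF e g(1,2)]) simp
    then have "real_of_int (3 ^ r) \<le> real_of_int (max_variation (int_box (4 * M)) g)"
      by (rule of_int_le_iff[THEN iffD2])
    then have "3 ^ r \<le> real_of_int (max_variation (int_box (4 * M)) g)"
      by (simp only: of_int_power of_int_numeral)
    with g(3) less show False by linarith
  qed
  then show ?thesis
    using separable_convex_interleaved[of e] by blast
qed

end
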